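(* Let $A_1$ and $A_2$ be finite $\mathcal{S}$-algebras and let $f:R(A_1)\to R(A_2)$ be an $\mathcal{S}$-function. Then the $\Pi$-function $F_f:A_2\to A_1$ associated to $f$ is an $\mathcal{S}$-epimorphism.
   Context: A De Morgan algebra is a bounded distributive lattice $\langle A,\wedge,\vee,0,1\rangle$ with a unary operation $\sim$ satisfying $\sim\sim x=x$ and $\sim(x\wedge y)=\sim x\vee\sim y$. An $mpM$-algebra is a De Morgan algebra with a unary operation ${}^\ast$ satisfying $x\wedge(x\wedge y)^\ast=x\wedge y^\ast$, $x\wedge 0^\ast=x$, $0^{\ast\ast}=0$ and $x\vee\sim x\le x\vee x^\ast$; put $\nabla x=\sim(\sim x\wedge x^\ast)$. An $\mathcal{S}$-algebra is a pair $(A,T)$ with $A$ an $mpM$-algebra and $T:A\to A$ an $mpM$-automorphism with $T(T(x))=x$ for all $x$. An $\mathcal{S}$-epimorphism is a surjective map preserving $\wedge,\vee,\sim,{}^\ast,0,1,T$. For finite $A$, $\Pi(A)$ is the ordered set of prime elements of $A$ ($p\neq 0$ such that $p\le x\vee y$ implies $p\le x$ or $p\le y$). For a prime filter $P$ put $\varphi(P)=A\setminus\{\sim x:x\in P\}$, which is a prime filter; $\psi:\Pi(A)\to\Pi(A)$ is defined by $\psi(p)=q$ iff $\varphi([p))=[q)$, where $[p)=\{x:p\le x\}$. Let $R(A)=\Pi(A)\cup\{\nabla p:p\in\Pi(A)\}$. A function $f:R(A_1)\to R(A_2)$ (mapping $\Pi(A_1)$ into $\Pi(A_2)$) is an $\mathcal{S}$-function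 if $f$ is one-to-one and, for every $p\in\Pi(A_1)$, $f(\psi(p))=\psi(f(p))$, $f(\nabla p)=\nabla f(p)$ and $f(T(p))=T(f(p))$. For $x\in A_2$ let $A^r_x=\{q\in R(A_1): f(q)\le x\}$ and $A^\pi_x=\{p\in\Pi(A_1): f(p)\le x\}$. The $\Pi$-function $F_f:A_2\to A_1$ associated to $f$ is given by $F_f(x)=\bigvee_{q\in A^r_x}q$ if $A^\pi_x\neq\emptyset$, and $F_f(x)=0$ if $A^\pi_x=\emptyset$. *)

theory Defs
  imports Main "HOL-Library.FuncSet"
begin

unbundle lattice_syntax

text \<open>
  The bounded distributive lattice underlying an algebra is a type of sort
  \<open>{distrib_lattice, bounded_lattice}\<close>, with \<open>0 = \<bottom>\<close> and \<open>1 = \<top>\<close>; the remaining operations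
  are explicit parameters, so that one statement can speak about several algebras.
\<close>

locale de_morgan_algebra =
  fixes neg :: "'a::{distrib_lattice, bounded_lattice} \<Rightarrow> 'a"
  assumes neg_neg: "neg (neg x) = x"
    and neg_inf: "neg (x \<sqinter> y) = neg x \<squnion> neg y"

locale mpM_algebra = de_morgan_algebra neg
  for neg :: "'a::{distrib_lattice, bounded_lattice} \<Rightarrow> 'a" +
  fixes star :: "'a \<Rightarrow> 'a"
  assumes inf_star_inf: "x \<sqinter> star (x \<sqinter> y) = x \<sqinter> star y"
    and inf_star_bot: "x \<sqinter> star \<bottom> = x"
    and star_star_bot: "star (star \<bottom>) = \<bottom>"
    and sup_neg_le_sup_star: "x \<squnion> neg x \<le> x \<squnion> star x"

definition nabla :: "('a::{distrib_lattice, bounded_lattice} \<Rightarrow> 'a) \<Rightarrow> ('a \<Rightarrow> 'a) \<Rightarrow> 'a \<Rightarrow> 'a" where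
  "nabla neg star x = neg (neg x \<sqinter> star x)"

definition mpM_hom ::
  "('a::{distrib_lattice, bounded_lattice} \<Rightarrow> 'a) \<Rightarrow> ('a \<Rightarrow> 'a) \<Rightarrow>
   ('b::{distrib_lattice, bounded_lattice} \<Rightarrow> 'b) \<Rightarrow> ('b \<Rightarrow> 'b) \<Rightarrow> ('a \<Rightarrow> 'b) \<Rightarrow> bool" where
  "mpM_hom neg\<^sub>1 star\<^sub>1 neg\<^sub>2 star\<^sub>2 h \<longleftrightarrow>
     (\<forall>x y. h (x \<sqinter> y) = h x \<sqinter> h y) \<and>
     (\<forall>x y. h (x \<squnion> y) = h x \<squnion> h y) \<and>
     (\<forall>x. h (neg\<^sub>1 x) = neg\<^sub>2 (h x)) \<and>
     (\<forall>x. h (star\<^sub>1 x) = star\<^sub>2 (h x)) \<and>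
     h \<bottom> = \<bottom> \<and> h \<top> = \<top>"

locale S_algebra = mpM_algebra neg star
  for neg star :: "'a::{distrib_lattice, bounded_lattice} \<Rightarrow> 'a" +
  fixes T :: "'a \<Rightarrow> 'a"
  assumes T_hom: "mpM_hom neg star neg star T"
    and T_bij: "bij T"
    and T_T: "T (T x) = x"

definition S_epimorphism ::
  "('a::{distrib_lattice, bounded_lattice} \<Rightarrow> 'a) \<Rightarrow> ('a \<Rightarrow> 'a) \<Rightarrow> ('a \<Rightarrow> 'a) \<Rightarrow>
   ('b::{distrib_lattice, bounded_lattice} \<Rightarrow> 'b) \<Rightarrow> ('b \<Rightarrow> 'b) \<Rightarrow> ('b \<Rightarrow> 'b) \<Rightarrow>
   ('a \<Rightarrow> 'b) \<Rightarrow> bool" where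
  "S_epimorphism neg\<^sub>1 star\<^sub>1 T\<^sub>1 neg\<^sub>2 star\<^sub>2 T\<^sub>2 h \<longleftrightarrow>
     surj h \<and> mpM_hom neg\<^sub>1 star\<^sub>1 neg\<^sub>2 star\<^sub>2 h \<and> (\<forall>x. h (T\<^sub>1 x) = T\<^sub>2 (h x))"

definition prime_elems :: "'a::{distrib_lattice, bounded_lattice} set" where
  "prime_elems = {p. p \<noteq> \<bottom> \<and> (\<forall>x y. p \<le> x \<squnion> y \<longrightarrow> p \<le> x \<or> p \<le> y)}"

definition phi :: "('a::{distrib_lattice, bounded_lattice} \<Rightarrow> 'a) \<Rightarrow> 'a set \<Rightarrow> 'a set" where
  "phi neg P = UNIV - neg ` P"

definition psi :: "('a::{distrib_lattice, bounded_lattice} \<Rightarrow> 'a) \<Rightarrow> 'a \<Rightarrow> 'a" where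
  "psi neg p = (THE q. q \<in> prime_elems \<and> phi neg {p..} = {q..})"

text \<open>In the finite case the description in \<^const>\<open>psi\<close> is proper on prime elements.\<close>

lemma (in de_morgan_algebra) psi_ex1:
  assumes fin: "finite (UNIV :: 'a set)" and p: "p \<in> prime_elems"
  shows "\<exists>!q. q \<in> prime_elems \<and> phi neg {p..} = {q..}"
proof -
  define S where "S = {x. \<not> p \<le> neg x}"
  have neg_sup: "neg (x \<squnion> y) = neg x \<sqinter> neg y" for x y
    by (metis neg_neg neg_inf)
  have anti: "neg y \<le> neg x" if "x \<le> y" for x y
    by (metis neg_inf inf.absorb1 sup.cobounded2 that)
  have neg_top: "neg \<top> = \<bottom>"
    by (metis anti neg_neg top_greatest bot.extremum_uniqueI)
  have neg_bot: "neg \<bottom> = \<top>"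
    by (metis neg_neg neg_top)
  have phi_S: "phi neg {p..} = S"
    unfolding phi_def S_def by (auto simp: neg_neg) (metis atLeast_iff imageI neg_neg)
  have pb: "p \<noteq> \<bottom>" and pp: "\<And>x y. p \<le> x \<squnion> y \<Longrightarrow> p \<le> x \<or> p \<le> y"
    using p by (auto simp: prime_elems_def)
  have S_top: "\<top> \<in> S"
    using pb by (auto simp: S_def neg_top bot_unique)
  have S_inf: "x \<sqinter> y \<in> S" if "x \<in> S" "y \<in> S" for x y
    using that pp by (auto simp: S_def neg_inf)
  have S_up: "y \<in> S" if "x \<in> S" "x \<le> y" for x y
    using that anti order_trans by (fastforce simp: S_def)
  have finS: "finite S"
    using fin by (rule rev_finite_subset) simp
  define q where "q = \<Sqinter>\<^sub>f\<^sub>i\<^sub>n S"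
  have "\<Sqinter>\<^sub>f\<^sub>i\<^sub>n F \<in> S" if "finite F" "F \<noteq> {}" "F \<subseteq> S" for F
    using that by (induction F rule: finite_ne_induct) (auto intro: S_inf)
  then have qS: "q \<in> S"
    unfolding q_def using finS S_top by blast
  have S_eq: "S = {q..}"
    using qS S_up finS by (auto simp: q_def intro: Inf_fin.coboundedI)
  have "q \<in> prime_elems"
    unfolding prime_elems_def
  proof (intro CollectI conjI allI impI)
    show "q \<noteq> \<bottom>"
      using qS by (auto simp: S_def neg_bot)
    show "q \<le> x \<or> q \<le> y" if "q \<le> x \<squnion> y" for x y
    proof -
      have "x \<squnion> y \<in> S" using that S_eq by auto
      then have "x \<in> S \<or> y \<in> S" by (auto simp: S_def neg_sup)
      then show ?thesis using S_eq by auto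
    qed
  qed
  then show ?thesis
    using S_eq phi_S by auto
qed

definition R_set :: "('a::{distrib_lattice, bounded_lattice} \<Rightarrow> 'a) \<Rightarrow> ('a \<Rightarrow> 'a) \<Rightarrow> 'a set" where
  "R_set neg star = prime_elems \<union> {nabla neg star p | p. p \<in> prime_elems}"

text \<open>A map between the sets \<open>R\<close> is represented by a total function whose values outside
  \<open>R\<close> are irrelevant.\<close>

definition S_function ::
  "('a::{distrib_lattice, bounded_lattice} \<Rightarrow> 'a) \<Rightarrow> ('a \<Rightarrow> 'a) \<Rightarrow> ('a \<Rightarrow> 'a) \<Rightarrow>
   ('b::{distrib_lattice, bounded_lattice} \<Rightarrow> 'b) \<Rightarrow> ('b \<Rightarrow> 'b) \<Rightarrow> ('b \<Rightarrow> 'b) \<Rightarrow>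
   ('a \<Rightarrow> 'b) \<Rightarrow> bool" where
  "S_function neg\<^sub>1 star\<^sub>1 T\<^sub>1 neg\<^sub>2 star\<^sub>2 T\<^sub>2 f \<longleftrightarrow>
     f \<in> R_set neg\<^sub>1 star\<^sub>1 \<rightarrow> R_set neg\<^sub>2 star\<^sub>2 \<and>
     f \<in> prime_elems \<rightarrow> prime_elems \<and>
     inj_on f (R_set neg\<^sub>1 star\<^sub>1) \<and>
     (\<forall>p\<in>prime_elems.
        f (psi neg\<^sub>1 p) = psi neg\<^sub>2 (f p) \<and>
        f (nabla neg\<^sub>1 star\<^sub>1 p) = nabla neg\<^sub>2 star\<^sub>2 (f p) \<and>
        f (T\<^sub>1 p) = T\<^sub>2 (f p))"

definition A_r ::
  "('a::{distrib_lattice, bounded_lattice} \<Rightarrow> 'a) \<Rightarrow> ('a \<Rightarrow> 'a) \<Rightarrow>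
   ('a \<Rightarrow> 'b::{distrib_lattice, bounded_lattice}) \<Rightarrow> 'b \<Rightarrow> 'a set" where
  "A_r neg\<^sub>1 star\<^sub>1 f x = {q \<in> R_set neg\<^sub>1 star\<^sub>1. f q \<le> x}"

definition A_pi ::
  "('a::{distrib_lattice, bounded_lattice} \<Rightarrow> 'b::{distrib_lattice, bounded_lattice}) \<Rightarrow>
   'b \<Rightarrow> 'a set" where
  "A_pi f x = {p \<in> prime_elems. f p \<le> x}"

text \<open>The join is only taken over a nonempty set, as \<^term>\<open>A_pi f x \<subseteq> A_r neg\<^sub>1 star\<^sub>1 f x\<close>.\<close>

definition Pi_function ::
  "('a::{distrib_lattice, bounded_lattice} \<Rightarrow> 'a) \<Rightarrow> ('a \<Rightarrow> 'a) \<Rightarrow>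
   ('a \<Rightarrow> 'b::{distrib_lattice, bounded_lattice}) \<Rightarrow> 'b \<Rightarrow> 'a" where
  "Pi_function neg\<^sub>1 star\<^sub>1 f x =
     (if A_pi f x \<noteq> {} then \<Squnion>\<^sub>f\<^sub>i\<^sub>n (A_r neg\<^sub>1 star\<^sub>1 f x) else \<bottom>)"

end

theory Submission
  imports Defs
begin

text \<open>
  A finite distributive lattice is determined by its poset of prime elements, so every claim about
  the \<open>\<Pi>\<close>-function \<open>F\<close> can be tested on primes. The axiom \<open>x \<squnion> \<sim>x \<le> x \<squnion> x\<^sup>*\<close> makes the poset of
  primes of an mpM-algebra almost trivial: together with the order-reversing involution \<open>\<psi>\<close>, it
  forces every connected component to be contained in some pair \<open>{p, \<psi> p}\<close>
  (\<open>prime_le_prime_iff\<close>). Consequently \<open>\<nabla>p = p \<squnion> \<psi> p\<close> for every prime \<open>p\<close> (\<open>nabla_prime\<close>), so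
  the order relation between \<open>p\<close> and \<open>\<psi> p\<close> is encoded in the equation \<open>\<nabla>p = p\<close>.

  An \<open>\<S>\<close>-function \<open>f\<close> commutes with \<open>\<psi>\<close> and \<open>\<nabla>\<close> and is injective on \<open>R\<close>, so it both preserves and
  reflects that equation. Hence \<open>f\<close> is an order embedding of primes (\<open>map_le_map_iff\<close>), and its image
  is a down-set, because everything below \<open>f p\<close> is \<open>f p\<close> or \<open>\<psi> (f p) = f (\<psi> p)\<close>. The elements \<open>\<nabla>p\<close>
  contribute nothing new to the join defining \<open>F x\<close>, and one obtains the duality
  \<open>p \<le> F x \<longleftrightarrow> f p \<le> x\<close> for primes \<open>p\<close> (\<open>prime_le_Pi_function_iff\<close>). Each operation has a
  description on primes: \<open>p \<le> \<sim>x\<close> means that \<open>\<psi> p \<le> x\<close> fails, \<open>p \<le> x\<^sup>*\<close> means that no prime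
  below \<open>p\<close> is below \<open>x\<close>, and \<open>p \<le> T x\<close> means \<open>T p \<le> x\<close>. The duality transports these descriptions
  along \<open>f\<close>, which gives the homomorphism laws; surjectivity is the reflection of order by \<open>f\<close>.
\<close>

section \<open>Prime elements of finite distributive lattices\<close>

lemma prime_ne_bot: "p \<in> prime_elems \<Longrightarrow> p \<noteq> \<bottom>"
  by (simp add: prime_elems_def)

lemma prime_le_sup_iff:
  "p \<in> prime_elems \<Longrightarrow> p \<le> x \<squnion> y \<longleftrightarrow> p \<le> x \<or> p \<le> y"
  by (auto simp: prime_elems_def intro: le_supI1 le_supI2)

lemma not_prime_le_bot: "p \<in> prime_elems \<Longrightarrow> \<not> p \<le> \<bottom>"
  by (auto simp: prime_elems_def bot_unique)

lemma prime_le_Sup_fin_iff: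
  assumes "p \<in> prime_elems" "finite S" "S \<noteq> {}"
  shows "p \<le> \<Squnion>\<^sub>f\<^sub>i\<^sub>n S \<longleftrightarrow> (\<exists>s\<in>S. p \<le> s)"
  using assms(2,3)
  by (induction S rule: finite_ne_induct) (auto simp: prime_le_sup_iff[OF assms(1)])

text \<open>
  A minimal element among those below \<open>x\<close> but not below \<open>y\<close> is join-irreducible, and
  distributivity turns join-irreducibility into primality.
\<close>

lemma ex_separating_prime:
  fixes x y :: "'a::{finite, distrib_lattice, bounded_lattice}"
  assumes "\<not> x \<le> y"
  shows "\<exists>p\<in>prime_elems. p \<le> x \<and> \<not> p \<le> y"
proof -
  have "\<exists>p\<in>{z. z \<le> x \<and> \<not> z \<le> y}. \<forall>z\<in>{z. z \<le> x \<and> \<not> z \<le> y}. z \<le> p \<longrightarrow> p = z"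
    by (rule finite_has_minimal) (use assms in auto)
  then obtain p where p: "p \<le> x" "\<not> p \<le> y"
    and minimal: "\<And>z. z \<le> p \<Longrightarrow> \<not> z \<le> y \<Longrightarrow> p = z"
    by (metis (mono_tags, lifting) mem_Collect_eq order_trans)
  have "p \<in> prime_elems"
    unfolding prime_elems_def
  proof (intro CollectI conjI allI impI)
    show "p \<noteq> \<bottom>" using p by auto
    show "p \<le> a \<or> p \<le> b" if "p \<le> a \<squnion> b" for a b
    proof (rule ccontr)
      assume "\<not> (p \<le> a \<or> p \<le> b)"
      then have "p \<sqinter> a \<le> y" "p \<sqinter> b \<le> y"
        using minimal by (metis inf.cobounded1 inf.cobounded2)+
      moreover have "p = (p \<sqinter> a) \<squnion> (p \<sqinter> b)"
        using that by (simp add: inf_sup_distrib1[symmetric] inf.absorb1)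
      ultimately show False using p(2) by (metis le_supI)
    qed
  qed
  with p show ?thesis by blast
qed

lemma eq_if_same_primes:
  fixes x y :: "'a::{finite, distrib_lattice, bounded_lattice}"
  assumes "\<And>p. p \<in> prime_elems \<Longrightarrow> p \<le> x \<longleftrightarrow> p \<le> y"
  shows "x = y"
  using assms ex_separating_prime by (metis order.antisym)

section \<open>The order on primes of a finite mpM-algebra\<close>

locale finite_mpM_algebra = mpM_algebra neg star
  for neg star :: "'a::{finite, distrib_lattice, bounded_lattice} \<Rightarrow> 'a"
begin

abbreviation \<psi> :: "'a \<Rightarrow> 'a" where "\<psi> \<equiv> psi neg"
abbreviation nab :: "'a \<Rightarrow> 'a" where "nab \<equiv> nabla neg star"

lemma psi_spec: "p \<in> prime_elems \<Longrightarrow> \<psi> p \<in> prime_elems \<and> phi neg {p..} = {\<psi> p..}"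
  unfolding psi_def by (rule theI'[OF psi_ex1]) simp_all

lemma psi_prime: "p \<in> prime_elems \<Longrightarrow> \<psi> p \<in> prime_elems"
  using psi_spec by blast

lemma le_neg_iff:
  assumes "p \<in> prime_elems"
  shows "p \<le> neg x \<longleftrightarrow> \<not> \<psi> p \<le> x"
proof -
  have "x \<in> neg ` {p..} \<longleftrightarrow> p \<le> neg x"
    by (metis atLeast_iff imageE image_eqI neg_neg)
  moreover have "\<psi> p \<le> x \<longleftrightarrow> x \<in> phi neg {p..}"
    using psi_spec[OF assms] by simp
  ultimately show ?thesis by (simp add: phi_def)
qed

lemma psi_psi: "p \<in> prime_elems \<Longrightarrow> \<psi> (\<psi> p) = p"
  by (metis le_neg_iff neg_neg order.antisym order_refl psi_prime)

lemma psi_antimono: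
  "p \<in> prime_elems \<Longrightarrow> q \<in> prime_elems \<Longrightarrow> p \<le> q \<Longrightarrow> \<psi> q \<le> \<psi> p"
  using le_neg_iff[of p "\<psi> p"] le_neg_iff[of q "\<psi> p"] by (auto dest: order_trans)

lemma star_bot: "star \<bottom> = \<top>"
  by (metis inf_star_bot inf_top_left)

lemma le_star_iff: "y \<le> star x \<longleftrightarrow> y \<sqinter> x = \<bottom>"
proof
  assume "y \<le> star x"
  moreover have "x \<sqinter> star x = \<bottom>"
    by (metis inf_star_inf inf_top_right star_bot star_star_bot inf_bot_right)
  ultimately show "y \<sqinter> x = \<bottom>"
    by (metis bot_unique inf.commute inf_mono order_refl)
next
  assume "y \<sqinter> x = \<bottom>"
  then show "y \<le> star x"
    by (metis inf.cobounded2 inf_star_bot inf_star_inf)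
qed

lemma prime_le_star_iff:
  "y \<le> star x \<longleftrightarrow> (\<forall>r\<in>prime_elems. r \<le> y \<longrightarrow> \<not> r \<le> x)"
  unfolding le_star_iff
  by (metis bot.extremum ex_separating_prime le_inf_iff not_prime_le_bot order.antisym)

text \<open>
  Evaluating \<open>r \<squnion> \<sim>r \<le> r \<squnion> r\<^sup>*\<close> at \<open>p\<close> gives \<open>p \<le> r\<close> or \<open>\<psi> p \<le> r\<close> whenever \<open>r \<le> p\<close>.
  If \<open>r < p\<close>, the second case holds, and the same dichotomy for \<open>\<psi> p \<le> r\<close> excludes
  \<open>\<psi> p < r\<close>: it would give \<open>\<psi> r \<le> \<psi> p\<close>, hence \<open>p \<le> r\<close>.
\<close>

lemma prime_le_prime_iff:
  assumes p: "p \<in> prime_elems" and r: "r \<in> prime_elems"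
  shows "r \<le> p \<longleftrightarrow> r = p \<or> r = \<psi> p \<and> \<psi> p \<le> p"
proof
  have dichotomy: "b \<le> a \<or> \<psi> b \<le> a"
    if "a \<in> prime_elems" "b \<in> prime_elems" "a \<le> b" for a b
  proof (rule ccontr)
    assume none: "\<not> (b \<le> a \<or> \<psi> b \<le> a)"
    then have "b \<le> neg a" using that le_neg_iff by blast
    then have "b \<le> a \<squnion> star a" by (metis le_supI2 order_trans sup_neg_le_sup_star)
    then have "b \<le> star a" using none that prime_le_sup_iff by blast
    then show False using that prime_le_star_iff by blast
  qed
  assume "r \<le> p"
  show "r = p \<or> r = \<psi> p \<and> \<psi> p \<le> p"
  proof (cases "p \<le> r")
    case False
    then have below: "\<psi> p \<le> r" using dichotomy[OF r p \<open>r \<le> p\<close>] by blast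
    have "\<not> \<psi> r \<le> \<psi> p"
      using False psi_antimono[of "\<psi> r" "\<psi> p"] p r by (auto simp: psi_psi psi_prime)
    then have "r \<le> \<psi> p" using dichotomy[OF psi_prime[OF p] r below] by blast
    with below \<open>r \<le> p\<close> show ?thesis by (metis order.antisym)
  qed (use \<open>r \<le> p\<close> in auto)
qed auto

text \<open>
  Expanding the definition, \<open>q \<le> \<nabla>p\<close> says that \<open>q \<le> p\<close> or that \<open>\<psi> q\<close> and \<open>p\<close> have a common
  lower bound among the primes. Such a bound puts \<open>q\<close> in the component of \<open>p\<close>.
\<close>

lemma nabla_prime:
  assumes p: "p \<in> prime_elems"
  shows "nab p = p \<squnion> \<psi> p"
proof (rule eq_if_same_primes)
  fix q :: 'a assume q: "q \<in> prime_elems"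
  have "q \<le> nab p \<longleftrightarrow> \<not> \<psi> q \<le> neg p \<or> \<not> \<psi> q \<le> star p"
    unfolding nabla_def using le_neg_iff[OF q] by simp
  also have "\<dots> \<longleftrightarrow> q \<le> p \<or> (\<exists>r\<in>prime_elems. r \<le> \<psi> q \<and> r \<le> p)"
    using le_neg_iff[OF psi_prime[OF q]] psi_psi[OF q] prime_le_star_iff by auto
  also have "\<dots> \<longleftrightarrow> q \<le> p \<or> q \<le> \<psi> p"
  proof
    assume "q \<le> p \<or> (\<exists>r\<in>prime_elems. r \<le> \<psi> q \<and> r \<le> p)"
    then show "q \<le> p \<or> q \<le> \<psi> p"
    proof
      assume "\<exists>r\<in>prime_elems. r \<le> \<psi> q \<and> r \<le> p"
      then obtain r where r: "r \<in> prime_elems" "r \<le> \<psi> q" "r \<le> p" by blast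
      then have "r = p \<or> r = \<psi> p" "r = \<psi> q \<or> r = q"
        using prime_le_prime_iff p q psi_prime psi_psi by metis+
      then show ?thesis
        using r p q by (metis order_refl psi_psi)
    qed simp
  next
    assume "q \<le> p \<or> q \<le> \<psi> p"
    then show "q \<le> p \<or> (\<exists>r\<in>prime_elems. r \<le> \<psi> q \<and> r \<le> p)"
      using p q psi_antimono[of q "\<psi> p"] by (metis order_refl psi_prime psi_psi)
  qed
  also have "\<dots> \<longleftrightarrow> q \<le> p \<squnion> \<psi> p" using prime_le_sup_iff[OF q] by blast
  finally show "q \<le> nab p \<longleftrightarrow> q \<le> p \<squnion> \<psi> p" .
qed

lemma nabla_eq_self_iff: "p \<in> prime_elems \<Longrightarrow> nab p = p \<longleftrightarrow> \<psi> p \<le> p"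
  by (simp add: nabla_prime sup.absorb_iff1)

end

section \<open>The involution of an S-algebra\<close>

context S_algebra
begin

lemma le_T_iff: "x \<le> T y \<longleftrightarrow> T x \<le> y"
  using T_hom T_T unfolding mpM_hom_def by (metis inf.absorb_iff1)

lemma T_prime:
  assumes "p \<in> prime_elems"
  shows "T p \<in> prime_elems"
  unfolding prime_elems_def
proof (intro CollectI conjI allI impI)
  show "T p \<noteq> \<bottom>"
    using prime_ne_bot[OF assms] T_hom T_T unfolding mpM_hom_def by metis
  show "T p \<le> x \<or> T p \<le> y" if "T p \<le> x \<squnion> y" for x y
    using that T_hom prime_le_sup_iff[OF assms]
    by (simp add: le_T_iff[symmetric] mpM_hom_def)
qed

end

section \<open>Duality between S-functions and their \<open>\<Pi>\<close>-functions\<close>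

locale S_function_between =
  A: S_algebra neg\<^sub>1 star\<^sub>1 T\<^sub>1 + B: S_algebra neg\<^sub>2 star\<^sub>2 T\<^sub>2
  for neg\<^sub>1 star\<^sub>1 T\<^sub>1 :: "'a::{finite, distrib_lattice, bounded_lattice} \<Rightarrow> 'a"
    and neg\<^sub>2 star\<^sub>2 T\<^sub>2 :: "'b::{finite, distrib_lattice, bounded_lattice} \<Rightarrow> 'b" +
  fixes f :: "'a \<Rightarrow> 'b"
  assumes S_fun: "S_function neg\<^sub>1 star\<^sub>1 T\<^sub>1 neg\<^sub>2 star\<^sub>2 T\<^sub>2 f"
begin

sublocale FA: finite_mpM_algebra neg\<^sub>1 star\<^sub>1 ..
sublocale FB: finite_mpM_algebra neg\<^sub>2 star\<^sub>2 ..

abbreviation F :: "'b \<Rightarrow> 'a" where "F \<equiv> Pi_function neg\<^sub>1 star\<^sub>1 f"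

lemma map_prime: "p \<in> prime_elems \<Longrightarrow> f p \<in> prime_elems"
  using S_fun unfolding S_function_def by blast

lemma map_psi: "p \<in> prime_elems \<Longrightarrow> f (FA.\<psi> p) = FB.\<psi> (f p)"
  using S_fun unfolding S_function_def by blast

lemma map_nabla: "p \<in> prime_elems \<Longrightarrow> f (FA.nab p) = FB.nab (f p)"
  using S_fun unfolding S_function_def by blast

lemma map_T: "p \<in> prime_elems \<Longrightarrow> f (T\<^sub>1 p) = T\<^sub>2 (f p)"
  using S_fun unfolding S_function_def by blast

lemma map_eq_iff:
  "x \<in> R_set neg\<^sub>1 star\<^sub>1 \<Longrightarrow> y \<in> R_set neg\<^sub>1 star\<^sub>1 \<Longrightarrow> f x = f y \<longleftrightarrow> x = y"
  using S_fun unfolding S_function_def by (blast dest: inj_onD)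

lemma prime_in_R: "p \<in> prime_elems \<Longrightarrow> p \<in> R_set neg\<^sub>1 star\<^sub>1"
  by (simp add: R_set_def)

lemma nabla_in_R: "p \<in> prime_elems \<Longrightarrow> FA.nab p \<in> R_set neg\<^sub>1 star\<^sub>1"
  by (auto simp: R_set_def)

text \<open>
  Whether \<open>\<psi> p \<le> p\<close> is the equation \<open>\<nabla>p = p\<close> between elements of \<open>R\<close>, so injectivity of \<open>f\<close> on
  all of \<open>R\<close>, not just on primes, is what makes \<open>f\<close> reflect it.
\<close>

lemma psi_map_le_map_iff:
  assumes p: "p \<in> prime_elems"
  shows "FB.\<psi> (f p) \<le> f p \<longleftrightarrow> FA.\<psi> p \<le> p"
proof -
  have "FB.\<psi> (f p) \<le> f p \<longleftrightarrow> f (FA.nab p) = f p"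
    using FB.nabla_eq_self_iff[OF map_prime[OF p]] map_nabla[OF p] by simp
  also have "\<dots> \<longleftrightarrow> FA.nab p = p"
    by (rule map_eq_iff[OF nabla_in_R[OF p] prime_in_R[OF p]])
  also have "\<dots> \<longleftrightarrow> FA.\<psi> p \<le> p" by (rule FA.nabla_eq_self_iff[OF p])
  finally show ?thesis .
qed

lemma map_le_map_iff:
  assumes p: "p \<in> prime_elems" and r: "r \<in> prime_elems"
  shows "f r \<le> f p \<longleftrightarrow> r \<le> p"
proof -
  have "f r \<le> f p \<longleftrightarrow> f r = f p \<or> f r = FB.\<psi> (f p) \<and> FB.\<psi> (f p) \<le> f p"
    by (rule FB.prime_le_prime_iff[OF map_prime[OF p] map_prime[OF r]])
  also have "\<dots> \<longleftrightarrow> f r = f p \<or> f r = f (FA.\<psi> p) \<and> FA.\<psi> p \<le> p"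
    using psi_map_le_map_iff[OF p] map_psi[OF p] by simp
  also have "\<dots> \<longleftrightarrow> r = p \<or> r = FA.\<psi> p \<and> FA.\<psi> p \<le> p"
    using p r by (simp add: map_eq_iff prime_in_R FA.psi_prime)
  also have "\<dots> \<longleftrightarrow> r \<le> p" by (rule FA.prime_le_prime_iff[OF p r, symmetric])
  finally show ?thesis .
qed

lemma ex_preimage_of_le_map:
  assumes p: "p \<in> prime_elems" and s: "s \<in> prime_elems" "s \<le> f p"
  shows "\<exists>r\<in>prime_elems. s = f r"
  using s p FB.prime_le_prime_iff[OF map_prime[OF p] s(1)] map_psi FA.psi_prime by metis

text \<open>
  A generator \<open>\<nabla>r = r \<squnion> \<psi> r\<close> with \<open>f (\<nabla>r) = f r \<squnion> f (\<psi> r) \<le> x\<close> is the join of two primes that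
  \<open>f\<close> also sends below \<open>x\<close>; a prime below one of these generators is mapped below \<open>x\<close>
  because \<open>f\<close> is monotone.
\<close>

lemma prime_le_Pi_function_iff:
  assumes p: "p \<in> prime_elems"
  shows "p \<le> F x \<longleftrightarrow> f p \<le> x"
proof
  assume le: "p \<le> F x"
  then have nonempty: "A_pi f x \<noteq> {}"
    using not_prime_le_bot[OF p] by (auto simp: Pi_function_def)
  then have "A_r neg\<^sub>1 star\<^sub>1 f x \<noteq> {}"
    using prime_in_R by (auto simp: A_pi_def A_r_def)
  then obtain q where q: "q \<in> R_set neg\<^sub>1 star\<^sub>1" "f q \<le> x" "p \<le> q"
    using le nonempty prime_le_Sup_fin_iff[OF p finite]
    by (auto simp: Pi_function_def A_r_def)
  have "\<exists>r\<in>prime_elems. p \<le> r \<and> f r \<le> x"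
  proof (cases "q \<in> prime_elems")
    case False
    then obtain r where r: "r \<in> prime_elems" "q = FA.nab r"
      using q(1) by (auto simp: R_set_def)
    have "f r \<squnion> f (FA.\<psi> r) \<le> x"
      using q(2) r by (simp add: map_nabla map_psi FB.nabla_prime map_prime)
    moreover have "p \<le> r \<or> p \<le> FA.\<psi> r"
      using q(3) r by (simp add: FA.nabla_prime prime_le_sup_iff[OF p])
    ultimately show ?thesis using r FA.psi_prime by auto
  qed (use q in blast)
  then show "f p \<le> x" using map_le_map_iff p by (meson order_trans)
next
  assume "f p \<le> x"
  then have "A_pi f x \<noteq> {}" "p \<in> A_r neg\<^sub>1 star\<^sub>1 f x"
    using p by (auto simp: A_pi_def A_r_def prime_in_R)
  then show "p \<le> F x"
    by (simp add: Pi_function_def Sup_fin.coboundedI)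
qed

section \<open>The \<open>\<Pi>\<close>-function is an epimorphism\<close>

lemma F_inf: "F (x \<sqinter> y) = F x \<sqinter> F y"
  by (rule eq_if_same_primes) (simp add: prime_le_Pi_function_iff)

lemma F_sup: "F (x \<squnion> y) = F x \<squnion> F y"
  by (rule eq_if_same_primes)
    (simp add: prime_le_Pi_function_iff prime_le_sup_iff map_prime)

lemma F_bot: "F \<bottom> = \<bottom>"
  by (rule eq_if_same_primes)
    (simp add: prime_le_Pi_function_iff not_prime_le_bot map_prime del: le_bot)

lemma F_top: "F \<top> = \<top>"
  by (rule eq_if_same_primes) (simp add: prime_le_Pi_function_iff)

lemma F_neg: "F (neg\<^sub>2 x) = neg\<^sub>1 (F x)"
  by (rule eq_if_same_primes)
    (simp add: prime_le_Pi_function_iff FA.le_neg_iff FB.le_neg_iff map_prime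
      map_psi[symmetric] FA.psi_prime)

text \<open>
  Pseudocomplements quantify over all primes below \<open>f p\<close>; they match the primes below \<open>p\<close> since
  the image of \<open>f\<close> is a down-set.
\<close>

lemma F_star: "F (star\<^sub>2 x) = star\<^sub>1 (F x)"
proof (rule eq_if_same_primes)
  fix p :: 'a assume p: "p \<in> prime_elems"
  have "p \<le> F (star\<^sub>2 x) \<longleftrightarrow> (\<forall>s\<in>prime_elems. s \<le> f p \<longrightarrow> \<not> s \<le> x)"
    by (simp add: prime_le_Pi_function_iff[OF p] FB.prime_le_star_iff)
  also have "\<dots> \<longleftrightarrow> (\<forall>r\<in>prime_elems. r \<le> p \<longrightarrow> \<not> f r \<le> x)"
    using ex_preimage_of_le_map[OF p] map_le_map_iff[OF p] map_prime by metis
  also have "\<dots> \<longleftrightarrow> p \<le> star\<^sub>1 (F x)"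
    by (simp add: FA.prime_le_star_iff prime_le_Pi_function_iff)
  finally show "p \<le> F (star\<^sub>2 x) \<longleftrightarrow> p \<le> star\<^sub>1 (F x)" .
qed

lemma F_T: "F (T\<^sub>2 x) = T\<^sub>1 (F x)"
  by (rule eq_if_same_primes)
    (simp add: prime_le_Pi_function_iff A.le_T_iff B.le_T_iff A.T_prime map_T[symmetric])

text \<open>
  A preimage of \<open>y\<close> is the join of the images of the primes below \<open>y\<close>. Adding \<open>\<bottom>\<close> to this finite
  set keeps the join defined when \<open>y = \<bottom>\<close>.
\<close>

lemma surj_F: "surj F"
proof (rule surjI)
  fix y
  define S where "S = insert \<bottom> (f ` {r \<in> prime_elems. r \<le> y})"
  show "F (\<Squnion>\<^sub>f\<^sub>i\<^sub>n S) = y"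
  proof (rule eq_if_same_primes)
    fix p :: 'a assume p: "p \<in> prime_elems"
    have "p \<le> F (\<Squnion>\<^sub>f\<^sub>i\<^sub>n S) \<longleftrightarrow> (\<exists>s\<in>S. f p \<le> s)"
      using prime_le_Sup_fin_iff[OF map_prime[OF p] finite, of S]
      by (simp add: prime_le_Pi_function_iff[OF p] S_def)
    also have "\<dots> \<longleftrightarrow> (\<exists>r\<in>prime_elems. r \<le> y \<and> p \<le> r)"
      using not_prime_le_bot[OF map_prime[OF p]] map_le_map_iff p unfolding S_def by blast
    also have "\<dots> \<longleftrightarrow> p \<le> y" using p by (blast intro: order_trans)
    finally show "p \<le> F (\<Squnion>\<^sub>f\<^sub>i\<^sub>n S) \<longleftrightarrow> p \<le> y" .
  qed
qed

end

theorem theorem3p10: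
  fixes neg\<^sub>1 star\<^sub>1 T\<^sub>1 :: "'a::{finite, distrib_lattice, bounded_lattice} \<Rightarrow> 'a"
    and neg\<^sub>2 star\<^sub>2 T\<^sub>2 :: "'b::{finite, distrib_lattice, bounded_lattice} \<Rightarrow> 'b"
    and f :: "'a \<Rightarrow> 'b"
  assumes "S_algebra neg\<^sub>1 star\<^sub>1 T\<^sub>1"
    and "S_algebra neg\<^sub>2 star\<^sub>2 T\<^sub>2"
    and "S_function neg\<^sub>1 star\<^sub>1 T\<^sub>1 neg\<^sub>2 star\<^sub>2 T\<^sub>2 f"
  shows "S_epimorphism neg\<^sub>2 star\<^sub>2 T\<^sub>2 neg\<^sub>1 star\<^sub>1 T\<^sub>1 (Pi_function neg\<^sub>1 star\<^sub>1 f)"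
proof -
  interpret S_function_between neg\<^sub>1 star\<^sub>1 T\<^sub>1 neg\<^sub>2 star\<^sub>2 T\<^sub>2 f
    using assms by (simp add: S_function_between_def S_function_between_axioms_def)
  show ?thesis
    unfolding S_epimorphism_def mpM_hom_def
    by (simp add: surj_F F_inf F_sup F_neg F_star F_bot F_top F_T)
qed

end
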